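(* Let $p$ be a prime. Then: (1) $\mathcal{K}_{p,2}\subsetneq\mathcal{K}_{p,1}$; (2) $\mathcal{W}_{p,2}\subsetneq\mathcal{W}_{p,1}$; (3) $\mathcal{K}_{p,2}=\widehat{\mathcal{K}}_{p,2}$; (4) every $f\in\mathcal{K}_{p,2}$ is strictly differentiable on $\mathbb{Z}_p$.
   Context: For $f:\mathbb{Z}_p\to\mathbb{Z}_p$, integers $n\ge0$, $h\ge1$, let $\Delta_h^n f(s)=\sum_{\nu=0}^n\binom{n}{\nu}(-1)^{n-\nu}f(s+\nu h)$ and $\Delta^n=\Delta_1^n$. $\mathcal{K}_{p,1}$ is the set of $f:\mathbb{Z}_p\to\mathbb{Z}_p$ such that for all $s\ne t$ in $\mathbb{Z}_p$ and all $n\ge0$: $s\equiv t\pmod{p^n\mathbb{Z}_p}$ implies $f(s)\equiv f(t)\pmod{p^{n+1}\mathbb{Z}_p}$. $\mathcal{W}_{p,1}$ is the set of $f\in\mathcal{K}_{p,1}$ for which the converse implication also holds (for all $s\neq t$, $n\ge 0$: $f(s)\equiv f(t)\pmod{p^{n+1}}$ implies $s\equiv t\pmod{p^n}$). $\mathcal{K}_{p,2}$ is the set of $f:\mathbb{Z}_p\to\mathbb{Z}_p$ with $\Delta^n f(s)\equiv0\pmod{p^n\mathbb{Z}_p}$ for all $s\in\mathbb{Z}_p$, $n\ge0$. For $f\in\mathcal{K}_{p,2}$ write $\Delta_f(n)=\Delta^nf(0)/p^n\in\mathbb{Z}_p$ and let $\Delta_f$ be the integer with $0\le\Delta_f<p$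 and $\Delta_f\equiv\Delta_f(1)\pmod p$. $\mathcal{W}_{p,2}$ is the set of $f\in\mathcal{K}_{p,2}$ with $\Delta_f\ne0$ and, in case $p=2$, additionally $2\mid\Delta_f(2)$. $\widehat{\mathcal{K}}_{p,2}$ is the set of $f:\mathbb{Z}_p\to\mathbb{Z}_p$ with $\Delta_h^n f(s)\equiv0\pmod{p^{n(1+\operatorname{ord}_p h)}\mathbb{Z}_p}$ for all $s\in\mathbb{Z}_p$, $n\ge0$, $h\ge1$. Strict differentiability is in the usual sense of $p$-adic analysis: $(f(x)-f(y))/(x-y)$ has a limit as $(x,y)\to(a,a)$, $x\ne y$, for every $a$.
   Formalization: In (1), (2) and (4) the functions in K_{p,2} and W_{p,2} are additionally assumed continuous; without this the claims fail, e.g. the indicator function of Z in Z_p lies in K_{p,2} but is discontinuous and not in K_{p,1}. *)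

theory Defs
  imports
    "HOL-Analysis.Product_Vector"
    "HOL-Computational_Algebra.Fraction_Field"
    "Berlekamp_Zassenhaus.Finite_Field"
begin

text \<open>
  The prime \<open>p\<close> is the cardinality \<open>CARD('p)\<close> of a type of class \<open>prime_card\<close>.
  The ring is the inverse limit of the rings \<open>Z/p^n Z\<close>; the \<open>n\<close>-th component of an element
  is its residue modulo \<open>p^n\<close>, represented in \<open>{0..<p^n}\<close>.
\<close>

typedef (overloaded) 'p::prime_card padic_int =
  "{x :: nat \<Rightarrow> int. \<forall>n. x n = x (Suc n) mod int CARD('p) ^ n}"
  morphisms residue Abs_padic_int
  by (rule exI[of _ "\<lambda>_. 0"]) simp

setup_lifting type_definition_padic_int

lemma prime_CARD: "prime (int CARD('p::prime_card))"
  using prime_card[where 'a = 'p] by simp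

lemma CARD_gt_1: "int CARD('p::prime_card) > 1"
  using prime_CARD[where 'p = 'p] by (rule prime_gt_1_int)

lemma mod_power_Suc: "(a mod b ^ Suc n) mod b ^ n = a mod (b::int) ^ n"
  by (rule mod_mod_cancel) (simp add: le_imp_power_dvd)

lemma residue_mod: "residue (x :: 'p::prime_card padic_int) n mod int CARD('p) ^ n = residue x n"
proof -
  have "residue x n = residue x (Suc n) mod int CARD('p) ^ n"
    using residue[of x] by blast
  then show ?thesis by (simp only: mod_mod_trivial)
qed

lemma padic_int_eqI: "(\<And>n. residue x n = residue y n) \<Longrightarrow> x = y"
  by (intro residue_inject[THEN iffD1] ext)

instantiation padic_int :: (prime_card) comm_ring_1
begin

lift_definition zero_padic_int :: "'a padic_int" is "\<lambda>_. 0"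
  by simp

lift_definition one_padic_int :: "'a padic_int" is "\<lambda>n. 1 mod int CARD('a) ^ n"
  by (simp only: mod_power_Suc)

lift_definition plus_padic_int :: "'a padic_int \<Rightarrow> 'a padic_int \<Rightarrow> 'a padic_int"
  is "\<lambda>x y n. (x n + y n) mod int CARD('a) ^ n"
proof -
  fix x y :: "nat \<Rightarrow> int" and n
  assume "\<And>n. x n = x (Suc n) mod int CARD('a) ^ n" "\<And>n. y n = y (Suc n) mod int CARD('a) ^ n"
  then have "x n = x (Suc n) mod int CARD('a) ^ n" "y n = y (Suc n) mod int CARD('a) ^ n"
    by blast+
  then show "(x n + y n) mod int CARD('a) ^ n
      = (x (Suc n) + y (Suc n)) mod int CARD('a) ^ Suc n mod int CARD('a) ^ n"
    by (simp only: mod_power_Suc mod_add_eq)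
qed

lift_definition times_padic_int :: "'a padic_int \<Rightarrow> 'a padic_int \<Rightarrow> 'a padic_int"
  is "\<lambda>x y n. (x n * y n) mod int CARD('a) ^ n"
proof -
  fix x y :: "nat \<Rightarrow> int" and n
  assume "\<And>n. x n = x (Suc n) mod int CARD('a) ^ n" "\<And>n. y n = y (Suc n) mod int CARD('a) ^ n"
  then have "x n = x (Suc n) mod int CARD('a) ^ n" "y n = y (Suc n) mod int CARD('a) ^ n"
    by blast+
  then show "(x n * y n) mod int CARD('a) ^ n
      = (x (Suc n) * y (Suc n)) mod int CARD('a) ^ Suc n mod int CARD('a) ^ n"
    by (simp only: mod_power_Suc mod_mult_eq)
qed

lift_definition minus_padic_int :: "'a padic_int \<Rightarrow> 'a padic_int \<Rightarrow> 'a padic_int"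
  is "\<lambda>x y n. (x n - y n) mod int CARD('a) ^ n"
proof -
  fix x y :: "nat \<Rightarrow> int" and n
  assume "\<And>n. x n = x (Suc n) mod int CARD('a) ^ n" "\<And>n. y n = y (Suc n) mod int CARD('a) ^ n"
  then have "x n = x (Suc n) mod int CARD('a) ^ n" "y n = y (Suc n) mod int CARD('a) ^ n"
    by blast+
  then show "(x n - y n) mod int CARD('a) ^ n
      = (x (Suc n) - y (Suc n)) mod int CARD('a) ^ Suc n mod int CARD('a) ^ n"
    by (simp only: mod_power_Suc mod_diff_eq)
qed

lift_definition uminus_padic_int :: "'a padic_int \<Rightarrow> 'a padic_int"
  is "\<lambda>x n. (- x n) mod int CARD('a) ^ n"
proof -
  fix x :: "nat \<Rightarrow> int" and n
  assume "\<And>n. x n = x (Suc n) mod int CARD('a) ^ n"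
  then have "x n = x (Suc n) mod int CARD('a) ^ n"
    by blast
  then show "(- x n) mod int CARD('a) ^ n
      = (- x (Suc n)) mod int CARD('a) ^ Suc n mod int CARD('a) ^ n"
    by (simp only: mod_power_Suc mod_minus_eq)
qed

instance
proof
  note reps = zero_padic_int.rep_eq one_padic_int.rep_eq plus_padic_int.rep_eq
    times_padic_int.rep_eq minus_padic_int.rep_eq uminus_padic_int.rep_eq
  fix a b c :: "'a padic_int"
  show "a * b * c = a * (b * c)"
    by (rule padic_int_eqI) (simp add: reps residue_mod mod_simps algebra_simps)
  show "a * b = b * a"
    by (rule padic_int_eqI) (simp add: reps residue_mod mod_simps algebra_simps)
  show "1 * a = a"
    by (rule padic_int_eqI) (simp add: reps residue_mod mod_simps algebra_simps)
  show "a + b + c = a + (b + c)"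
    by (rule padic_int_eqI) (simp add: reps residue_mod mod_simps algebra_simps)
  show "a + b = b + a"
    by (rule padic_int_eqI) (simp add: reps residue_mod mod_simps algebra_simps)
  show "0 + a = a"
    by (rule padic_int_eqI) (simp add: reps residue_mod mod_simps algebra_simps)
  show "- a + a = 0"
    by (rule padic_int_eqI) (simp add: reps residue_mod mod_simps algebra_simps)
  show "a - b = a + - b"
    by (rule padic_int_eqI) (simp add: reps residue_mod mod_simps algebra_simps)
  show "(a + b) * c = a * c + b * c"
    by (rule padic_int_eqI) (simp add: reps residue_mod mod_simps algebra_simps)
  show "(0 :: 'a padic_int) \<noteq> 1"
  proof
    assume "(0 :: 'a padic_int) = 1"
    then have "residue (0 :: 'a padic_int) 1 = residue (1 :: 'a padic_int) 1" by simp
    then show False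
      using CARD_gt_1[where 'p = 'a]
      by (simp add: zero_padic_int.rep_eq one_padic_int.rep_eq)
  qed
qed

end

lemma residue_mod_le:
  "n \<le> m \<Longrightarrow> residue (x :: 'p::prime_card padic_int) m mod int CARD('p) ^ n = residue x n"
proof (induction m rule: dec_induct)
  case base
  show ?case by (rule residue_mod)
next
  case (step m)
  have "residue x (Suc m) mod int CARD('p) ^ n
      = residue x (Suc m) mod int CARD('p) ^ m mod int CARD('p) ^ n"
    using step(1) by (simp add: mod_mod_cancel le_imp_power_dvd)
  also have "residue x (Suc m) mod int CARD('p) ^ m = residue x m"
    using residue[of x] by (metis (mono_tags, lifting) mem_Collect_eq)
  finally show ?case using step by simp
qed

lemma residue_of_nat: "residue (of_nat k :: 'p::prime_card padic_int) n = int k mod int CARD('p) ^ n"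
  by (induction k)
    (simp_all add: zero_padic_int.rep_eq plus_padic_int.rep_eq one_padic_int.rep_eq mod_simps)

lemma residue_p_power:
  "residue (of_nat CARD('p) ^ k :: 'p::prime_card padic_int) n
    = int CARD('p) ^ k mod int CARD('p) ^ n"
  using residue_of_nat[where 'p = 'p, of "CARD('p) ^ k" n] by simp

lemma p_power_dvd_iff:
  "of_nat CARD('p) ^ k dvd (x :: 'p::prime_card padic_int) \<longleftrightarrow> residue x k = 0"
proof
  assume "of_nat CARD('p) ^ k dvd x"
  then obtain y where "x = of_nat CARD('p) ^ k * y" unfolding dvd_def by blast
  then have "residue x k = int CARD('p) ^ k mod int CARD('p) ^ k * residue y k mod int CARD('p) ^ k"
    by (simp only: times_padic_int.rep_eq residue_p_power)
  then show "residue x k = 0"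
    by simp
next
  let ?q = "int CARD('p)"
  assume k: "residue x k = 0"
  have q0: "?q ^ k > 0" for k using CARD_gt_1[where 'p = 'p] by simp
  have dvd: "?q ^ k dvd residue x (n + k)" for n
    using residue_mod_le[of k "n + k" x] k by (simp only: dvd_eq_mod_eq_0 le_add2)
  define y :: "'p padic_int" where "y = Abs_padic_int (\<lambda>n. residue x (n + k) div ?q ^ k)"
  have "residue x (n + k) div ?q ^ k = residue x (Suc n + k) div ?q ^ k mod ?q ^ n" for n
  proof -
    obtain c where c: "residue x (Suc n + k) = ?q ^ k * c"
      using dvd[of "Suc n"] unfolding dvd_def by blast
    have "residue x (n + k) = ?q ^ k * c mod ?q ^ (n + k)"
      using residue_mod_le[of "n + k" "Suc n + k" x] c by simp
    also have "\<dots> = ?q ^ k * (c mod ?q ^ n)"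
      by (simp only: power_add mult.commute[of "?q ^ n"] mult_mod_right)
    finally show ?thesis
      using c q0[of k] by (metis less_irrefl nonzero_mult_div_cancel_left)
  qed
  then have "(\<lambda>n. residue x (n + k) div ?q ^ k)
      \<in> {x. \<forall>n. x n = x (Suc n) mod int CARD('p) ^ n}"
    by (intro CollectI allI)
  then have y: "residue y n = residue x (n + k) div ?q ^ k" for n
    unfolding y_def by (simp only: Abs_padic_int_inverse)
  have "residue x n = residue (of_nat CARD('p) ^ k * y) n" for n
  proof -
    have "residue (of_nat CARD('p) ^ k * y) n = ?q ^ k * (residue x (n + k) div ?q ^ k) mod ?q ^ n"
      by (simp only: times_padic_int.rep_eq residue_p_power y mod_mult_left_eq)
    also have "?q ^ k * (residue x (n + k) div ?q ^ k) = residue x (n + k)"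
      using dvd[of n] by (rule dvd_mult_div_cancel)
    also have "\<dots> mod ?q ^ n = residue x n"
      by (rule residue_mod_le) simp
    finally show ?thesis by (rule sym)
  qed
  then have "x = of_nat CARD('p) ^ k * y"
    by (rule padic_int_eqI)
  then show "of_nat CARD('p) ^ k dvd x" by simp
qed

lemma finite_p_power_dvd:
  assumes "(x :: 'p::prime_card padic_int) \<noteq> 0"
  shows "finite {n. of_nat CARD('p) ^ n dvd x}"
proof -
  obtain m where m: "residue x m \<noteq> 0"
    using assms by (metis padic_int_eqI zero_padic_int.rep_eq)
  have "n < m" if "of_nat CARD('p) ^ n dvd x" for n
  proof (rule ccontr)
    assume "\<not> n < m"
    then have "m \<le> n" by simp
    then have "of_nat CARD('p) ^ m dvd x"
      using that by (rule dvd_trans[OF le_imp_power_dvd])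
    with m show False by (simp add: p_power_dvd_iff)
  qed
  then show ?thesis by (intro finite_nat_iff_bounded[THEN iffD2] exI[of _ m]) auto
qed

definition padic_ord :: "'p::prime_card padic_int \<Rightarrow> nat" where
  "padic_ord x = Max {n. of_nat CARD('p) ^ n dvd x}"  \<comment> \<open>unspecified at \<open>0\<close>\<close>

definition padic_abs :: "'p::prime_card padic_int \<Rightarrow> real" where
  "padic_abs x = (if x = 0 then 0 else inverse (real CARD('p)) ^ padic_ord x)"

lemma p_power_dvd_iff_le_ord:
  assumes "(x :: 'p::prime_card padic_int) \<noteq> 0"
  shows "of_nat CARD('p) ^ n dvd x \<longleftrightarrow> n \<le> padic_ord x"
proof -
  have "0 \<in> {n. of_nat CARD('p) ^ n dvd x}" by simp
  then have "padic_ord x \<in> {n. of_nat CARD('p) ^ n dvd x}"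
    unfolding padic_ord_def using Max_in[OF finite_p_power_dvd[OF assms]] by blast
  then have ord: "of_nat CARD('p) ^ padic_ord x dvd x" by (rule CollectD)
  show ?thesis
  proof
    assume "of_nat CARD('p) ^ n dvd x"
    then show "n \<le> padic_ord x"
      unfolding padic_ord_def by (intro Max_ge finite_p_power_dvd assms CollectI)
  next
    assume "n \<le> padic_ord x"
    then show "of_nat CARD('p) ^ n dvd x"
      using ord by (rule dvd_trans[OF le_imp_power_dvd])
  qed
qed

lemma padic_mult:
  assumes "(x :: 'p::prime_card padic_int) \<noteq> 0" "y \<noteq> 0"
  shows "x * y \<noteq> 0 \<and> padic_ord (x * y) = padic_ord x + padic_ord y"
proof -
  let ?q = "int CARD('p)"
  have unit: "\<exists>u. z = of_nat CARD('p) ^ padic_ord z * u \<and> \<not> ?q dvd residue u 1"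
    if z: "z \<noteq> 0" for z :: "'p padic_int"
  proof -
    obtain u where u: "z = of_nat CARD('p) ^ padic_ord z * u"
      using p_power_dvd_iff_le_ord[OF z, of "padic_ord z"] unfolding dvd_def by blast
    have "\<not> of_nat CARD('p) ^ 1 dvd u"
    proof
      assume "of_nat CARD('p) ^ 1 dvd u"
      then have "of_nat CARD('p) ^ padic_ord z * of_nat CARD('p) ^ 1 dvd z"
        by (subst u) (rule mult_dvd_mono, simp_all)
      then have "of_nat CARD('p) ^ Suc (padic_ord z) dvd z"
        by (simp add: mult.commute)
      then have "Suc (padic_ord z) \<le> padic_ord z" using p_power_dvd_iff_le_ord[OF z] by blast
      then show False by simp
    qed
    then have "residue u 1 \<noteq> 0" using p_power_dvd_iff by blast
    then have "\<not> ?q dvd residue u 1"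
      using residue_mod[of u 1] by (auto simp: dvd_eq_mod_eq_0)
    with u show ?thesis by blast
  qed
  obtain u v where u: "x = of_nat CARD('p) ^ padic_ord x * u" "\<not> ?q dvd residue u 1"
    and v: "y = of_nat CARD('p) ^ padic_ord y * v" "\<not> ?q dvd residue v 1"
    using unit[OF assms(1)] unit[OF assms(2)] by blast
  define k where "k = padic_ord x + padic_ord y"
  define w where "w = u * v"
  have "\<not> ?q dvd residue u 1 * residue v 1"
    using u(2) v(2) prime_CARD[where 'p = 'p] prime_dvd_mult_iff by blast
  then have w1: "\<not> ?q dvd residue w 1"
    by (simp add: w_def times_padic_int.rep_eq dvd_eq_mod_eq_0)
  have xy: "x * y = of_nat CARD('p) ^ k * w"
    by (subst u(1), subst v(1)) (simp add: k_def w_def power_add mult_ac)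
  have "residue w (Suc k) mod ?q ^ 1 = residue w 1"
    by (rule residue_mod_le) simp
  then have "\<not> ?q dvd residue w (Suc k)"
    using w1 by (metis dvd_mod_iff dvd_refl power_one_right)
  then have "\<not> ?q ^ Suc k dvd ?q ^ k * residue w (Suc k)"
    using CARD_gt_1[where 'p = 'p] by (simp add: mult.commute)
  moreover have "residue (x * y) (Suc k) = ?q ^ k * residue w (Suc k) mod ?q ^ Suc k"
    by (simp add: xy times_padic_int.rep_eq residue_p_power mod_simps)
  ultimately have "residue (x * y) (Suc k) \<noteq> 0" by (simp add: dvd_eq_mod_eq_0)
  then have nd: "\<not> of_nat CARD('p) ^ Suc k dvd x * y" using p_power_dvd_iff by blast
  then have nz: "x * y \<noteq> 0" by auto
  have "k \<le> padic_ord (x * y)"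
    using p_power_dvd_iff_le_ord[OF nz, of k] xy by simp
  moreover have "\<not> Suc k \<le> padic_ord (x * y)"
    using p_power_dvd_iff_le_ord[OF nz, of "Suc k"] nd by simp
  ultimately show ?thesis using nz k_def by simp
qed

instance padic_int :: (prime_card) idom
  by standard (use padic_mult in blast)

lemma padic_abs_mult: "padic_abs (x * y) = padic_abs x * padic_abs y"
  using padic_mult[of x y] by (auto simp: padic_abs_def power_add)

lemma padic_abs_eq_0_iff: "padic_abs x = 0 \<longleftrightarrow> x = 0"
  by (simp add: padic_abs_def)

lemma padic_abs_nonneg: "padic_abs x \<ge> 0"
  by (simp add: padic_abs_def)

lemma padic_abs_le_iff:
  "padic_abs (x :: 'p::prime_card padic_int) \<le> inverse (real CARD('p)) ^ n
    \<longleftrightarrow> of_nat CARD('p) ^ n dvd x"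
proof (cases "x = 0")
  case False
  have "real CARD('p) > 1" using CARD_gt_1[where 'p = 'p] by linarith
  then show ?thesis
    using False p_power_dvd_iff_le_ord[OF False, of n]
    by (simp add: padic_abs_def power_inverse)
qed (simp add: padic_abs_def)

lemma padic_abs_minus_commute:
  "padic_abs (x - y) = padic_abs (y - x :: 'p::prime_card padic_int)"
proof -
  have "(z dvd x - y) = (z dvd y - x)" for z
    using dvd_minus_iff[of z "x - y"] by simp
  then show ?thesis by (simp add: padic_abs_def padic_ord_def)
qed

lemma padic_abs_add: "padic_abs (x + y) \<le> max (padic_abs x) (padic_abs (y :: 'p::prime_card padic_int))"
proof (cases "x = 0 \<or> y = 0")
  case True
  then show ?thesis by auto
next
  case False
  let ?n = "min (padic_ord x) (padic_ord y)"
  have "of_nat CARD('p) ^ ?n dvd x + y"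
    using False p_power_dvd_iff_le_ord[of x ?n] p_power_dvd_iff_le_ord[of y ?n] by simp
  then have "padic_abs (x + y) \<le> inverse (real CARD('p)) ^ ?n" by (simp only: padic_abs_le_iff)
  also have "\<dots> \<le> max (padic_abs x) (padic_abs y)"
    using False by (cases "padic_ord x \<le> padic_ord y") (simp_all add: padic_abs_def min_def)
  finally show ?thesis .
qed

instantiation padic_int :: (prime_card) metric_space
begin

definition dist_padic_int :: "'a padic_int \<Rightarrow> 'a padic_int \<Rightarrow> real" where
  "dist_padic_int x y = padic_abs (x - y)"

definition uniformity_padic_int :: "('a padic_int \<times> 'a padic_int) filter" where
  "uniformity_padic_int = (INF e\<in>{0 <..}. principal {(x, y). dist x y < e})"

definition open_padic_int :: "'a padic_int set \<Rightarrow> bool" where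
  "open_padic_int U \<longleftrightarrow> (\<forall>x\<in>U. eventually (\<lambda>(x', y). x' = x \<longrightarrow> y \<in> U) uniformity)"

instance
proof
  fix x y z :: "'a padic_int"
  show "dist x y = 0 \<longleftrightarrow> x = y"
    by (simp add: dist_padic_int_def padic_abs_eq_0_iff)
  have "padic_abs (x - y) \<le> max (padic_abs (x - z)) (padic_abs (z - y))"
    using padic_abs_add[of "x - z" "z - y"] by simp
  then show "dist x y \<le> dist x z + dist y z"
    using padic_abs_nonneg[of "x - z"] padic_abs_nonneg[of "y - z"]
    unfolding dist_padic_int_def padic_abs_minus_commute[of z y] by linarith
qed (rule uniformity_padic_int_def open_padic_int_def)+

end

text \<open>\<open>Q_p\<close> is the fraction field \<open>'p padic_int fract\<close>.\<close>

definition Qp_abs :: "'p::prime_card padic_int fract \<Rightarrow> real" where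
  "Qp_abs q = (THE r. \<exists>a b. b \<noteq> 0 \<and> q = Fract a b \<and> r = padic_abs a / padic_abs b)"

lemma Qp_abs_Fract:
  fixes a b :: "'p::prime_card padic_int"
  assumes "b \<noteq> 0"
  shows "Qp_abs (Fract a b) = padic_abs a / padic_abs b"
  unfolding Qp_abs_def
proof (rule the_equality)
  fix r
  assume "\<exists>c d. d \<noteq> 0 \<and> Fract a b = Fract c d \<and> r = padic_abs c / padic_abs d"
  then obtain c d where cd: "d \<noteq> 0" "Fract a b = Fract c d" "r = padic_abs c / padic_abs d"
    by blast
  then have "a * d = c * b" using assms by (simp add: eq_fract)
  then have "padic_abs a * padic_abs d = padic_abs c * padic_abs b"
    by (simp flip: padic_abs_mult)
  then show "r = padic_abs a / padic_abs b"
    using assms cd(1) by (simp add: cd(3) frac_eq_eq padic_abs_eq_0_iff)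
qed (use assms in \<open>intro exI[of _ a] exI[of _ b] conjI refl\<close>)


definition pcong :: "nat \<Rightarrow> 'p::prime_card padic_int \<Rightarrow> 'p padic_int \<Rightarrow> bool" where
  "pcong n x y \<longleftrightarrow> of_nat CARD('p) ^ n dvd x - y"

text \<open>\<open>fdiff h n f s\<close> is \<open>\<Delta>_h^n f(s)\<close>.\<close>

definition fdiff ::
  "nat \<Rightarrow> nat \<Rightarrow> ('p::prime_card padic_int \<Rightarrow> 'p padic_int) \<Rightarrow> 'p padic_int \<Rightarrow> 'p padic_int" where
  "fdiff h n f s = (\<Sum>\<nu>\<le>n. of_nat (n choose \<nu>) * (-1) ^ (n - \<nu>) * f (s + of_nat (\<nu> * h)))"

definition K1 :: "('p::prime_card padic_int \<Rightarrow> 'p padic_int) set" where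
  "K1 = {f. \<forall>s t n. s \<noteq> t \<longrightarrow> pcong n s t \<longrightarrow> pcong (n + 1) (f s) (f t)}"

definition W1 :: "('p::prime_card padic_int \<Rightarrow> 'p padic_int) set" where
  "W1 = {f \<in> K1. \<forall>s t n. s \<noteq> t \<longrightarrow> pcong (n + 1) (f s) (f t) \<longrightarrow> pcong n s t}"

text \<open>Membership in \<open>K2\<close> (hence in \<open>W2\<close>) does not imply continuity: the condition only relates values
  of \<open>f\<close> on a common coset of the integers. For example, the indicator function of the integers
  is a discontinuous element of \<open>K2\<close>, which does not lie in \<open>K1\<close>.\<close>

definition K2 :: "('p::prime_card padic_int \<Rightarrow> 'p padic_int) set" where
  "K2 = {f. \<forall>s n. pcong n (fdiff 1 n f s) 0}"

text \<open>The exact quotient \<open>\<Delta>^n f(0) / p^n\<close>; meaningful for \<open>f \<in> K2\<close>, where it exists, and it is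
  unique since the ring is a domain.\<close>

definition Delta_coeff :: "('p::prime_card padic_int \<Rightarrow> 'p padic_int) \<Rightarrow> nat \<Rightarrow> 'p padic_int" where
  "Delta_coeff f n = (THE c. of_nat CARD('p) ^ n * c = fdiff 1 n f 0)"

definition Delta_digit :: "('p::prime_card padic_int \<Rightarrow> 'p padic_int) \<Rightarrow> int" where
  "Delta_digit f = (THE d. 0 \<le> d \<and> d < int CARD('p) \<and> pcong 1 (of_int d) (Delta_coeff f 1))"

definition W2 :: "('p::prime_card padic_int \<Rightarrow> 'p padic_int) set" where
  "W2 = {f \<in> K2. Delta_digit f \<noteq> 0 \<and> (CARD('p) = 2 \<longrightarrow> 2 dvd Delta_coeff f 2)}"

definition K2_hat :: "('p::prime_card padic_int \<Rightarrow> 'p padic_int) set" where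
  "K2_hat = {f. \<forall>s n h. h \<ge> 1 \<longrightarrow> pcong (n * (1 + multiplicity CARD('p) h)) (fdiff h n f s) 0}"

text \<open>The difference quotients and their limit are elements of the field \<open>Q_p\<close>.\<close>

definition strictly_differentiable_at ::
  "('p::prime_card padic_int \<Rightarrow> 'p padic_int) \<Rightarrow> 'p padic_int \<Rightarrow> bool" where
  "strictly_differentiable_at f a \<longleftrightarrow>
    (\<exists>L. ((\<lambda>(x, y). Qp_abs (Fract (f x - f y) (x - y) - L)) \<longlongrightarrow> 0)
      (at (a, a) within {(x, y). x \<noteq> y}))"

end

theory Submission
  imports Defs "HOL-Analysis.Elementary_Metric_Spaces"
begin

text \<open>
  By Newton's formula \<open>f (s + h) - f s\<close> is the sum over \<open>j \<ge> 1\<close> of \<open>binom(h, j) \<Delta>^j f(s)\<close>, and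
  \<open>ord binom(h, j) \<ge> ord h - ord j\<close>. Hence for \<open>f\<close> in \<open>K2\<close> and \<open>p^v\<close> dividing \<open>h\<close> the increment
  \<open>f (s + h) - f s\<close> is \<open>p^(v+1)\<close> times another element of \<open>K2\<close>. Iterating this gives
  \<open>K2 = K2_hat\<close>; continuity carries the estimates from natural \<open>h\<close> to all increments. Newton's
  formula with step \<open>p^M\<close> shows that difference quotients near \<open>a\<close> agree modulo \<open>p^(M+1)\<close>.
\<close>

section \<open>Divisibility by powers of p, density of the naturals, completeness,
  continuity\<close>

abbreviation (input) uniformizer :: "'p::prime_card padic_int" where
  "uniformizer \<equiv> of_nat CARD('p)"

lemma uniformizer_nonzero: "(uniformizer :: 'p::prime_card padic_int) ^ n \<noteq> 0"
proof
  assume "(uniformizer :: 'p padic_int) ^ n = 0"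
  then have "residue (uniformizer ^ n :: 'p padic_int) (Suc n) = 0"
    by (simp only: zero_padic_int.rep_eq)
  then show False
    using CARD_gt_1[where 'p = 'p] by (simp add: residue_p_power)
qed

lemma uniformizer_power_dvd_of_nat:
  "(uniformizer :: 'p::prime_card padic_int) ^ n dvd of_nat h \<longleftrightarrow> CARD('p) ^ n dvd h"
proof -
  have "(int h mod int CARD('p) ^ n = 0) \<longleftrightarrow> int (CARD('p) ^ n) dvd int h"
    by (simp add: dvd_eq_mod_eq_0)
  then show ?thesis
    by (simp only: p_power_dvd_iff residue_of_nat int_dvd_int_iff)
qed

lemma uniformizer_prime:
  assumes "(uniformizer :: 'p::prime_card padic_int) dvd x * y"
  shows "uniformizer dvd x \<or> uniformizer dvd y"
proof (cases "x = 0 \<or> y = 0")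
  case True
  then show ?thesis by auto
next
  case False
  then have "1 \<le> padic_ord x + padic_ord y"
    using assms padic_mult[of x y] p_power_dvd_iff_le_ord[of "x * y" 1] by simp
  then have "1 \<le> padic_ord x \<or> 1 \<le> padic_ord y" by linarith
  then show ?thesis
    using False p_power_dvd_iff_le_ord[of x 1] p_power_dvd_iff_le_ord[of y 1] by simp
qed

text \<open>The residue of \<open>x\<close> modulo p^m is itself a natural number and serves as
  \<open>h\<close>.\<close>

lemma nat_dense_padic:
  "\<exists>h. (uniformizer :: 'p::prime_card padic_int) ^ m dvd x - of_nat h"
proof -
  have "residue x m = residue x m mod int CARD('p) ^ m"
    by (simp add: residue_mod)
  also have "\<dots> \<ge> 0"
    using CARD_gt_1[where 'p = 'p] by simp
  finally obtain h where h: "residue x m = int h"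
    using nonneg_int_cases by blast
  then have "int h mod int CARD('p) ^ m = int h"
    by (metis residue_mod)
  with h have "residue (x - of_nat h) m = 0"
    by (simp add: minus_padic_int.rep_eq residue_of_nat)
  then show ?thesis
    unfolding p_power_dvd_iff by blast
qed

text \<open>The diagonal residues \<open>residue (X n) n\<close> are compatible, hence define an
  element of the inverse limit.\<close>

lemma padic_complete:
  fixes X :: "nat \<Rightarrow> 'p::prime_card padic_int"
  assumes "\<And>n. uniformizer ^ n dvd X (Suc n) - X n"
  shows "\<exists>L. \<forall>n. uniformizer ^ n dvd L - X n"
proof -
  have eq: "residue (X n) n = residue (X (Suc n)) (Suc n) mod int CARD('p) ^ n" for n
  proof -
    have "(residue (X (Suc n)) n - residue (X n) n) mod int CARD('p) ^ n = 0"
      using assms[of n] by (simp only: p_power_dvd_iff minus_padic_int.rep_eq)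
    then have "residue (X (Suc n)) n mod int CARD('p) ^ n = residue (X n) n mod int CARD('p) ^ n"
      by (simp add: mod_eq_dvd_iff dvd_eq_mod_eq_0)
    then have "residue (X (Suc n)) n = residue (X n) n"
      by (simp add: residue_mod)
    then show ?thesis
      using residue_mod_le[of n "Suc n" "X (Suc n)"] by simp
  qed
  define L :: "'p padic_int" where "L = Abs_padic_int (\<lambda>n. residue (X n) n)"
  have "(\<lambda>n. residue (X n) n) \<in> {x. \<forall>n. x n = x (Suc n) mod int CARD('p) ^ n}"
    by (intro CollectI allI eq)
  then have "residue L n = residue (X n) n" for n
    unfolding L_def by (simp only: Abs_padic_int_inverse)
  then have "residue (L - X n) n = 0" for n
    by (simp add: minus_padic_int.rep_eq)
  then show ?thesis
    unfolding p_power_dvd_iff by blast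
qed

text \<open>The balls of radius p^(-m) form a neighbourhood base, and
  \<open>padic_abs_le_iff\<close> turns membership in such a ball into divisibility.\<close>

lemma continuous_padic_iff:
  fixes f :: "'p::prime_card padic_int \<Rightarrow> 'p padic_int"
  shows "continuous_on UNIV f \<longleftrightarrow>
    (\<forall>a n. \<exists>m. \<forall>x. uniformizer ^ m dvd x - a \<longrightarrow> uniformizer ^ n dvd f x - f a)"
    (is "_ \<longleftrightarrow> ?R")
proof -
  let ?q = "inverse (real CARD('p))"
  have p1: "real CARD('p) > 1" using CARD_gt_1[where 'p = 'p] by linarith
  then have q: "0 < ?q" "?q < 1" by (auto simp: field_simps)
  have small: "\<exists>n. ?q ^ n < e" if "0 < e" for e :: real
    using real_arch_pow_inv[OF that q(2)] .
  show ?thesis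
  proof
    assume f: "continuous_on UNIV f"
    show ?R
    proof (intro allI)
      fix a n
      have "0 < ?q ^ n" using q by simp
      then obtain d where d: "d > 0" "\<And>x. dist x a < d \<Longrightarrow> dist (f x) (f a) < ?q ^ n"
        using f unfolding continuous_on_iff by (metis UNIV_I)
      obtain m where m: "?q ^ m < d" using small[OF d(1)] by blast
      have "uniformizer ^ n dvd f x - f a" if "uniformizer ^ m dvd x - a" for x
      proof -
        have "dist x a \<le> ?q ^ m"
          using that by (simp only: dist_padic_int_def padic_abs_le_iff)
        then have "dist (f x) (f a) < ?q ^ n"
          using m by (intro d(2)) linarith
        then show ?thesis
          by (simp only: dist_padic_int_def flip: padic_abs_le_iff)
      qed
      then show "\<exists>m. \<forall>x. uniformizer ^ m dvd x - a \<longrightarrow> uniformizer ^ n dvd f x - f a"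
        by blast
    qed
  next
    assume R: ?R
    show "continuous_on UNIV f"
      unfolding continuous_on_iff
    proof (intro ballI allI impI)
      fix a and e :: real
      assume "0 < e"
      then obtain n where n: "?q ^ n < e" using small by blast
      obtain m where m: "\<And>x. uniformizer ^ m dvd x - a \<Longrightarrow> uniformizer ^ n dvd f x - f a"
        using R by blast
      have "dist (f x) (f a) < e" if "dist x a < ?q ^ m" for x
      proof -
        have "padic_abs (x - a) \<le> ?q ^ m" using that by (simp add: dist_padic_int_def)
        then have "padic_abs (f x - f a) \<le> ?q ^ n"
          unfolding padic_abs_le_iff by (rule m)
        then show ?thesis using n by (simp add: dist_padic_int_def)
      qed
      moreover have "?q ^ m > 0" using q by simp
      ultimately show "\<exists>d>0. \<forall>x\<in>UNIV. dist x a < d \<longrightarrow> dist (f x) (f a) < e"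
        by blast
    qed
  qed
qed

text \<open>Newton's formula only reaches the points \<open>y + of_nat h\<close>. Density supplies
  such points near \<open>x\<close>, and continuity makes the value there close to
  \<open>f x\<close> too.\<close>

lemma continuous_padic_approx:
  fixes f :: "'p::prime_card padic_int \<Rightarrow> 'p padic_int"
  assumes "continuous_on UNIV f"
  obtains h where "uniformizer ^ N dvd y + of_nat h - x"
    and "uniformizer ^ N dvd f (y + of_nat h) - f x"
proof -
  obtain m where m: "\<And>z. uniformizer ^ m dvd z - x \<Longrightarrow> uniformizer ^ N dvd f z - f x"
    using assms unfolding continuous_padic_iff by blast
  obtain h where "uniformizer ^ (max m N) dvd (x - y) - of_nat h"
    using nat_dense_padic by blast
  then have h: "uniformizer ^ (max m N) dvd y + of_nat h - x"
    using dvd_minus_iff[of _ "(x - y) - of_nat h"] by (simp add: algebra_simps)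
  have "uniformizer ^ m dvd y + of_nat h - x" "uniformizer ^ N dvd y + of_nat h - x"
    by (rule dvd_trans[OF _ h], simp add: le_imp_power_dvd)+
  then show ?thesis using m that by blast
qed

section \<open>Finite differences\<close>

lemma fdiff_0 [simp]: "fdiff h 0 f s = f s"
  by (simp add: fdiff_def)

lemma fdiff_Suc: "fdiff h (Suc n) f s = fdiff h n f (s + of_nat h) - fdiff h n f s"
proof -
  let ?F = "\<lambda>\<nu>. f (s + of_nat (\<nu> * h))"
  have shift: "fdiff h n f (s + of_nat h)
      = (\<Sum>\<nu>\<le>n. of_nat (n choose \<nu>) * (-1) ^ (n - \<nu>) * ?F (Suc \<nu>))"
    unfolding fdiff_def by (simp add: algebra_simps)
  have low: "fdiff h n f s
      = (-1) ^ n * f s - (\<Sum>\<nu>\<le>n. of_nat (n choose Suc \<nu>) * (-1) ^ (n - \<nu>) * ?F (Suc \<nu>))"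
  proof -
    have "fdiff h n f s = (\<Sum>\<nu>\<le>Suc n. of_nat (n choose \<nu>) * (-1) ^ (n - \<nu>) * ?F \<nu>)"
      unfolding fdiff_def by (simp add: binomial_eq_0)
    also have "\<dots> = (-1) ^ n * f s
        + (\<Sum>\<nu>\<le>n. of_nat (n choose Suc \<nu>) * (-1) ^ (n - Suc \<nu>) * ?F (Suc \<nu>))"
      by (subst sum.atMost_Suc_shift) simp
    also have "(\<Sum>\<nu>\<le>n. of_nat (n choose Suc \<nu>) * (-1) ^ (n - Suc \<nu>) * ?F (Suc \<nu>))
        = (\<Sum>\<nu>\<le>n. - (of_nat (n choose Suc \<nu>) * (-1) ^ (n - \<nu>) * ?F (Suc \<nu>)))"
    proof (rule sum.cong[OF refl])
      fix \<nu> assume "\<nu> \<in> {..n}"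
      \<comment> \<open>For \<open>\<nu> = n\<close> truncated subtraction spoils the sign, but then
        \<open>n choose Suc \<nu>\<close> vanishes.\<close>
      then consider "\<nu> = n" | "\<nu> < n" by fastforce
      then show "of_nat (n choose Suc \<nu>) * (-1) ^ (n - Suc \<nu>) * ?F (Suc \<nu>)
          = - (of_nat (n choose Suc \<nu>) * (-1) ^ (n - \<nu>) * ?F (Suc \<nu>))"
      proof cases
        case 2
        then have "n - \<nu> = Suc (n - Suc \<nu>)" by simp
        then show ?thesis by simp
      qed (simp add: binomial_eq_0)
    qed
    finally show ?thesis by (simp add: sum_negf)
  qed
  have "fdiff h (Suc n) f s = (-1) ^ Suc n * f s
      + (\<Sum>\<nu>\<le>n. of_nat (Suc n choose Suc \<nu>) * (-1) ^ (n - \<nu>) * ?F (Suc \<nu>))"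
    unfolding fdiff_def by (subst sum.atMost_Suc_shift) simp
  also have "\<dots> = fdiff h n f (s + of_nat h) - fdiff h n f s"
    unfolding shift low by (simp add: sum.distrib algebra_simps)
  finally show ?thesis .
qed

lemma fdiff_1 [simp]: "fdiff h (Suc 0) f s = f (s + of_nat h) - f s"
  by (simp add: fdiff_Suc)

lemma fdiff_diff: "fdiff h n (\<lambda>s. f s - g s) s = fdiff h n f s - fdiff h n g s"
  unfolding fdiff_def by (simp add: sum_subtractf right_diff_distrib)

lemma fdiff_cmult: "fdiff h n (\<lambda>s. c * f s) s = c * fdiff h n f s"
  unfolding fdiff_def by (simp add: sum_distrib_left mult_ac)

lemma fdiff_translate: "fdiff h n (\<lambda>s. f (s + c)) s = fdiff h n f (s + c)"
  unfolding fdiff_def by (simp add: add_ac)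

lemma fdiff_fdiff: "fdiff h m (fdiff h n f) s = fdiff h (m + n) f s"
  by (induction m arbitrary: s) (simp_all add: fdiff_Suc)

lemma fdiff_Suc': "fdiff h (Suc n) f s = fdiff h n (\<lambda>s. f (s + of_nat h) - f s) s"
  using fdiff_diff[of h n "\<lambda>s. f (s + of_nat h)" f s] by (simp add: fdiff_translate fdiff_Suc)

text \<open>In operator form, shift^k = (1 + \<Delta>_h)^k. The induction applies the hypothesis to
  the translate of \<open>f\<close> by \<open>h\<close>, and Pascal's rule recombines the
  sums.\<close>

lemma newton_expansion: "f (s + of_nat (k * h)) = (\<Sum>j\<le>k. of_nat (k choose j) * fdiff h j f s)"
proof (induction k arbitrary: f)
  case 0
  show ?case by simp
next
  case (Suc k)
  have "f (s + of_nat (Suc k * h)) = (\<lambda>s. f (s + of_nat h)) (s + of_nat (k * h))"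
    by (simp add: algebra_simps)
  also have "\<dots> = (\<Sum>j\<le>k. of_nat (k choose j) * (fdiff h j f s + fdiff h (Suc j) f s))"
    by (subst Suc) (simp add: fdiff_translate fdiff_Suc)
  also have "\<dots> = (\<Sum>j\<le>Suc k. of_nat (k choose j) * fdiff h j f s)
      + (\<Sum>j\<le>k. of_nat (k choose j) * fdiff h (Suc j) f s)"
    by (simp add: distrib_left sum.distrib binomial_eq_0)
  also have "\<dots> = (\<Sum>j\<le>Suc k. of_nat (Suc k choose j) * fdiff h j f s)"
    by (simp only: sum.atMost_Suc_shift) (simp add: sum.distrib distrib_right)
  finally show ?case .
qed

lemma newton_increment:
  "f (s + of_nat (k * h)) - f s = (\<Sum>j=1..k. of_nat (k choose j) * fdiff h j f s)"
  unfolding newton_expansion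
  by (simp add: atMost_atLeast0 sum.atLeast_Suc_atMost)

lemma newton_increment_2:
  "f (s + of_nat (k * h)) - f s
    = of_nat k * fdiff h 1 f s + (\<Sum>j=2..k. of_nat (k choose j) * fdiff h j f s)"
proof (cases "k = 0")
  case False
  then show ?thesis
    unfolding newton_increment by (simp add: sum.atLeast_Suc_atMost numeral_2_eq_2)
qed simp

text \<open>In j * binom(k, j) = k * binom(k-1, j-1) the right side is divisible by q^v. The part of
  \<open>j\<close> prime to \<open>q\<close> cancels, so only the power of \<open>q\<close> in
  \<open>j\<close> is lost.\<close>

lemma power_dvd_choose:
  fixes q :: nat
  assumes "prime q" "q ^ v dvd k" "1 \<le> j"
  shows "q ^ v dvd (k choose j) * q ^ multiplicity q j"
proof (cases "k = 0")
  case True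
  then show ?thesis using assms(3) by (simp add: binomial_eq_0)
next
  case False
  obtain r where r: "j = q ^ multiplicity q j * r" "\<not> q dvd r"
    using multiplicity_decompose'[of j q] assms(1,3)
    by (metis not_one_le_zero not_prime_unit)
  have "k * (k - 1 choose (j - 1)) = j * (k choose j)"
    using times_binomial_minus1_eq[of j k] assms(3) by simp
  then have "q ^ v dvd j * (k choose j)"
    using assms(2) by (metis dvd_mult2)
  then have "q ^ v dvd r * ((k choose j) * q ^ multiplicity q j)"
    using r(1) by (metis mult.assoc mult.commute)
  moreover have "coprime (q ^ v) r"
    using r(2) assms(1) by (simp add: prime_imp_coprime)
  ultimately show ?thesis
    by (simp add: coprime_dvd_mult_right_iff)
qed

lemma multiplicity_lt_self:
  fixes q :: nat
  assumes "prime q" "1 \<le> j"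
  shows "multiplicity q j < j"
proof -
  have "2 ^ multiplicity q j \<le> q ^ multiplicity q j"
    using prime_ge_2_nat[OF assms(1)] by (rule power_mono) simp
  also have "\<dots> \<le> j"
    using assms(2) by (intro dvd_imp_le multiplicity_dvd) simp
  finally show ?thesis
    using less_exp[of "multiplicity q j"] by linarith
qed

text \<open>Failure means multiplicity j - 1, hence q^(j-1) <= j, which leaves only q = j = 2. This
  exception is where the condition for p = 2 in \<open>W2\<close> enters.\<close>

lemma Suc_multiplicity_lt_self:
  fixes q :: nat
  assumes "prime q" "2 \<le> j" "q \<noteq> 2 \<or> j \<noteq> 2"
  shows "Suc (multiplicity q j) < j"
proof (rule ccontr)
  assume "\<not> Suc (multiplicity q j) < j"
  then have m: "multiplicity q j = j - 1"
    using multiplicity_lt_self[OF assms(1), of j] assms(2) by linarith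
  have le: "q ^ (j - 1) \<le> j"
    using assms(2) by (subst m[symmetric], intro dvd_imp_le multiplicity_dvd) simp
  have q2: "2 \<le> q" using prime_ge_2_nat[OF assms(1)] .
  show False
  proof (cases "j = 2")
    case True
    then show False using le q2 assms(3) by simp
  next
    case False
    then obtain i where i: "j = i + 3" using assms(2) by (metis add.commute le_Suc_ex numeral_2_eq_2 numeral_3_eq_3 Suc_leI le_neq_implies_less)
    have "i + 3 < 2 ^ (i + 2)" by (induction i) auto
    also have "(2::nat) ^ (i + 2) \<le> q ^ (i + 2)" using q2 by (rule power_mono) simp
    finally show False using le i by simp
  qed
qed

text \<open>Bookkeeping for Newton terms: of the exponent \<open>e + w\<close> of \<open>x\<close>,
  at most \<open>e\<close> is spent on the multiplicity of \<open>j\<close>, and \<open>w\<close>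
  survives on top of the \<open>v\<close> coming from \<open>k\<close>.\<close>

lemma uniformizer_power_dvd_choose:
  assumes "CARD('p::prime_card) ^ v dvd k" "1 \<le> j" "multiplicity CARD('p) j \<le> e"
    and "uniformizer ^ (e + w) dvd (x :: 'p padic_int)"
  shows "uniformizer ^ (v + w) dvd of_nat (k choose j) * x"
proof -
  have "CARD('p) ^ v dvd (k choose j) * CARD('p) ^ multiplicity CARD('p) j"
    by (rule power_dvd_choose[OF prime_card assms(1,2)])
  also have "\<dots> dvd (k choose j) * CARD('p) ^ e"
    using assms(3) by (intro mult_dvd_mono le_imp_power_dvd) simp_all
  finally have "(uniformizer :: 'p padic_int) ^ v dvd of_nat ((k choose j) * CARD('p) ^ e)"
    by (simp only: uniformizer_power_dvd_of_nat)
  then have "(uniformizer :: 'p padic_int) ^ v * uniformizer ^ w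
      dvd of_nat ((k choose j) * CARD('p) ^ e) * uniformizer ^ w"
    by (rule mult_dvd_mono) simp
  also have "\<dots> = of_nat (k choose j) * (uniformizer ^ (e + w))"
    by (simp add: power_add mult_ac)
  also have "\<dots> dvd of_nat (k choose j) * x"
    using assms(4) by (rule mult_dvd_mono[OF dvd_refl])
  finally show ?thesis by (simp add: power_add)
qed

section \<open>The set \<open>K2\<close> and its differences\<close>

lemma K2_iff: "f \<in> K2 \<longleftrightarrow> (\<forall>s n. uniformizer ^ n dvd fdiff 1 n f s)"
  by (simp add: K2_def pcong_def)

text \<open>The quotient stays in the same class, so the step can be iterated. In Newton's formula
  for the n-th difference of \<open>f\<close> the j-th term carries p^(j+n) and loses at most
  p^(j-1), which leaves p^(v+n+1).\<close>

lemma K2_increment: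
  fixes f :: "'p::prime_card padic_int \<Rightarrow> 'p padic_int"
  assumes f: "f \<in> K2" and h: "CARD('p) ^ v dvd h"
  obtains g where "g \<in> K2" "\<And>s. f (s + of_nat h) - f s = uniformizer ^ Suc v * g s"
    "continuous_on UNIV f \<Longrightarrow> continuous_on UNIV g"
proof -
  let ?D = "\<lambda>s. f (s + of_nat h) - f s"
  have dvd: "uniformizer ^ (Suc v + n) dvd fdiff 1 n ?D s" for n s
  proof -
    have "fdiff 1 n ?D s = fdiff 1 n f (s + of_nat h) - fdiff 1 n f s"
      by (simp add: fdiff_diff fdiff_translate)
    also have "\<dots> = (\<Sum>j=1..h. of_nat (h choose j) * fdiff 1 j (fdiff 1 n f) s)"
      using newton_increment[of "fdiff 1 n f" s h 1] by simp
    also have "uniformizer ^ (v + Suc n) dvd \<dots>"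
    proof (rule dvd_sum)
      fix j assume j: "j \<in> {1..h}"
      then have m: "multiplicity CARD('p) j \<le> j - 1"
        using multiplicity_lt_self[of "CARD('p)" j] prime_card[where 'a = 'p] by fastforce
      have "uniformizer ^ (j - 1 + Suc n) dvd fdiff 1 j (fdiff 1 n f) s"
        using f j unfolding K2_iff fdiff_fdiff by (metis add_Suc_shift Suc_pred' One_nat_def
            atLeastAtMost_iff less_eq_Suc_le)
      from uniformizer_power_dvd_choose[OF h _ m this]
      show "uniformizer ^ (v + Suc n) dvd of_nat (h choose j) * fdiff 1 j (fdiff 1 n f) s"
        using j by simp
    qed
    finally show ?thesis by simp
  qed
  have "\<forall>s. \<exists>y. ?D s = uniformizer ^ Suc v * y"
    using dvd[of 0] unfolding dvd_def by simp
  then obtain g where g: "\<And>s. ?D s = uniformizer ^ Suc v * g s" by metis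
  have "uniformizer ^ n dvd fdiff 1 n g s" for n s
  proof -
    have "uniformizer ^ Suc v * uniformizer ^ n dvd uniformizer ^ Suc v * fdiff 1 n g s"
      using dvd[of n s] unfolding g fdiff_cmult by (simp only: power_add)
    then show ?thesis
      using uniformizer_nonzero by (simp only: dvd_mult_cancel_left) blast
  qed
  then have "g \<in> K2" by (simp add: K2_iff)
  moreover have "continuous_on UNIV g" if cf: "continuous_on UNIV f"
    unfolding continuous_padic_iff
  proof (intro allI)
    fix a n
    obtain m1 where m1: "\<And>x. uniformizer ^ m1 dvd x - (a + of_nat h)
        \<Longrightarrow> uniformizer ^ (Suc v + n) dvd f x - f (a + of_nat h)"
      using cf unfolding continuous_padic_iff by blast
    obtain m2 where m2: "\<And>x. uniformizer ^ m2 dvd x - a \<Longrightarrow> uniformizer ^ (Suc v + n) dvd f x - f a"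
      using cf unfolding continuous_padic_iff by blast
    have "uniformizer ^ n dvd g x - g a" if x: "uniformizer ^ (max m1 m2) dvd x - a" for x
    proof -
      have "uniformizer ^ m1 dvd (x + of_nat h) - (a + of_nat h)" "uniformizer ^ m2 dvd x - a"
        using dvd_trans[OF _ x] by (simp_all add: le_imp_power_dvd)
      then have "uniformizer ^ (Suc v + n) dvd (f (x + of_nat h) - f (a + of_nat h)) - (f x - f a)"
        using m1 m2 by (blast intro: dvd_diff)
      also have "(f (x + of_nat h) - f (a + of_nat h)) - (f x - f a) = ?D x - ?D a"
        by simp
      also have "\<dots> = uniformizer ^ Suc v * (g x - g a)"
        unfolding g by (simp only: right_diff_distrib)
      finally show ?thesis
        using uniformizer_nonzero by (simp only: power_add dvd_mult_cancel_left) blast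
    qed
    then show "\<exists>m. \<forall>x. uniformizer ^ m dvd x - a \<longrightarrow> uniformizer ^ n dvd g x - g a"
      by blast
  qed
  ultimately show ?thesis using g that by blast
qed

text \<open>Each order contributes one factor p^(v+1): the increment is p^(v+1) times another member
  of \<open>K2\<close>, to which the hypothesis applies. Hence \<open>f\<close> is arbitrary in the
  induction.\<close>

lemma K2_fdiff_dvd:
  fixes f :: "'p::prime_card padic_int \<Rightarrow> 'p padic_int"
  assumes "f \<in> K2" "CARD('p) ^ v dvd h"
  shows "uniformizer ^ (n * Suc v) dvd fdiff h n f s"
  using assms(1)
proof (induction n arbitrary: f)
  case 0
  show ?case by simp
next
  case (Suc n)
  obtain g where g: "g \<in> K2" "\<And>s. f (s + of_nat h) - f s = uniformizer ^ Suc v * g s"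
    using K2_increment[OF Suc.prems assms(2)] by blast
  have "fdiff h (Suc n) f s = uniformizer ^ Suc v * fdiff h n g s"
    by (simp only: fdiff_Suc' g(2) fdiff_cmult)
  moreover have "uniformizer ^ Suc v * uniformizer ^ (n * Suc v)
      dvd uniformizer ^ Suc v * fdiff h n g s"
    using Suc.IH[OF g(1)] by (rule mult_dvd_mono[OF dvd_refl])
  ultimately show ?case by (simp only: mult_Suc power_add)
qed

text \<open>Forward, \<open>v\<close> is the multiplicity of p in \<open>h\<close>; backward,
  \<open>h = 1\<close> has multiplicity 0.\<close>

lemma K2_eq_K2_hat: "(K2 :: ('p::prime_card padic_int \<Rightarrow> 'p padic_int) set) = K2_hat"
proof (intro equalityI subsetI)
  fix f :: "'p padic_int \<Rightarrow> 'p padic_int"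
  assume "f \<in> K2"
  then have "uniformizer ^ (n * Suc (multiplicity CARD('p) h)) dvd fdiff h n f s" for s n h
    by (rule K2_fdiff_dvd) (rule multiplicity_dvd)
  then show "f \<in> K2_hat"
    by (simp add: K2_hat_def pcong_def)
next
  fix f :: "'p padic_int \<Rightarrow> 'p padic_int"
  assume "f \<in> K2_hat"
  then have "pcong (n * (1 + multiplicity CARD('p) 1)) (fdiff 1 n f s) 0" for s n
    unfolding K2_hat_def by blast
  then show "f \<in> K2"
    by (simp add: K2_def)
qed

text \<open>Up to p^(n+1), \<open>x\<close> can be replaced by \<open>y + of_nat h\<close> in both
  argument and value. Then p^n divides \<open>h\<close>, and the first difference with step
  \<open>h\<close> gains the extra factor p.\<close>

lemma K2_continuous_lipschitz:
  fixes f :: "'p::prime_card padic_int \<Rightarrow> 'p padic_int"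
  assumes "f \<in> K2" "continuous_on UNIV f" and xy: "uniformizer ^ n dvd x - y"
  shows "uniformizer ^ Suc n dvd f x - f y"
proof -
  obtain h where h: "uniformizer ^ Suc n dvd y + of_nat h - x"
    and fh: "uniformizer ^ Suc n dvd f (y + of_nat h) - f x"
    using continuous_padic_approx[OF assms(2)] by blast
  have "uniformizer ^ n dvd y + of_nat h - x"
    using h by (rule power_le_dvd) simp
  then have "uniformizer ^ n dvd (y + of_nat h - x) + (x - y)"
    using xy by (rule dvd_add)
  then have "CARD('p) ^ n dvd h"
    by (simp add: uniformizer_power_dvd_of_nat)
  then have "uniformizer ^ Suc n dvd f (y + of_nat h) - f y"
    using K2_fdiff_dvd[OF assms(1), of n h 1 y] by simp
  from dvd_diff[OF this fh] show ?thesis by simp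
qed

lemma K2_continuous_subset_K1: "K2 \<inter> {f. continuous_on UNIV f} \<subseteq> K1"
  using K2_continuous_lipschitz by (auto simp: K1_def pcong_def)

section \<open>The set \<open>W2\<close>\<close>

lemma Delta_coeff_eqI:
  fixes f :: "'p::prime_card padic_int \<Rightarrow> 'p padic_int"
  assumes "fdiff 1 n f 0 = uniformizer ^ n * c"
  shows "Delta_coeff f n = c"
  unfolding Delta_coeff_def assms using uniformizer_nonzero[of n, where 'p = 'p] by auto

lemma Delta_digit_eq_0:
  fixes f :: "'p::prime_card padic_int \<Rightarrow> 'p padic_int"
  assumes "uniformizer dvd Delta_coeff f 1"
  shows "Delta_digit f = 0"
  unfolding Delta_digit_def
proof (rule the_equality)
  show "0 \<le> (0::int) \<and> 0 < int CARD('p) \<and> pcong 1 (of_int 0) (Delta_coeff f 1)"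
    using assms CARD_gt_1[where 'p = 'p] by (simp add: pcong_def)
next
  fix d assume d: "0 \<le> d \<and> d < int CARD('p) \<and> pcong 1 (of_int d) (Delta_coeff f 1)"
  then have "(uniformizer :: 'p padic_int) dvd of_int d - Delta_coeff f 1"
    by (simp add: pcong_def)
  from dvd_add[OF this assms] have "(uniformizer :: 'p padic_int) dvd of_int d"
    by simp
  then have "(uniformizer :: 'p padic_int) ^ 1 dvd of_nat (nat d)"
    using d by simp
  then have "CARD('p) dvd nat d"
    unfolding uniformizer_power_dvd_of_nat by simp
  then show "d = 0"
    using d by (metis dvd_imp_le nat_less_iff not_le nat_eq_iff2 gr0I of_nat_0)
qed

text \<open>In the Newton expansion of \<open>f (t + h) - f t\<close> only the linear term has valuation
  \<open>1 + ord h\<close>.  For \<open>p = 2\<close> the quadratic term would have the same valuation, and the condition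
  on \<open>\<Delta>\<^sub>f(2)\<close> in the definition of \<open>W2\<close> excludes this.\<close>

lemma W2_continuous_expansive:
  fixes f :: "'p::prime_card padic_int \<Rightarrow> 'p padic_int"
  assumes f: "f \<in> W2" "continuous_on UNIV f" and "s \<noteq> t"
    and n: "uniformizer ^ Suc n dvd f s - f t"
  shows "uniformizer ^ n dvd s - t"
proof (rule ccontr)
  assume not_n: "\<not> uniformizer ^ n dvd s - t"
  let ?P = "uniformizer :: 'p padic_int"
  have K2: "f \<in> K2" using f(1) by (simp add: W2_def)
  define v where "v = padic_ord (s - t)"
  have v: "?P ^ m dvd s - t \<longleftrightarrow> m \<le> v" for m
    using p_power_dvd_iff_le_ord[of "s - t"] \<open>s \<noteq> t\<close> by (simp add: v_def)
  \<comment> \<open>Failure at level \<open>n\<close> means \<open>v < n\<close>, so the assumed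
    precision \<open>Suc n\<close> is at least \<open>v + 2\<close>.\<close>
  have "?P ^ (v + 2) dvd f s - f t"
    using n not_n v by (intro power_le_dvd[OF n]) simp
  obtain h where h: "?P ^ (v + 2) dvd t + of_nat h - s"
    and fh: "?P ^ (v + 2) dvd f (t + of_nat h) - f s"
    using continuous_padic_approx[OF f(2)] by blast
  have inc: "?P ^ (v + 2) dvd f (t + of_nat h) - f t"
    using dvd_add[OF fh \<open>?P ^ (v + 2) dvd f s - f t\<close>] by simp
  \<comment> \<open>Precision \<open>v + 2\<close> is enough for \<open>h\<close> to inherit the
    exact order \<open>v\<close> of \<open>s - t\<close>.\<close>
  have hv: "?P ^ m dvd of_nat h \<longleftrightarrow> m \<le> v" if "m \<le> v + 2" for m
  proof -
    have "?P ^ m dvd t + of_nat h - s" using h that by (rule power_le_dvd)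
    from dvd_add_right_iff[OF this, of "s - t"] show ?thesis using v by simp
  qed
  have pv: "CARD('p) ^ v dvd h"
    using hv[of v] by (simp add: uniformizer_power_dvd_of_nat)
  \<comment> \<open>\<open>g1\<close> and \<open>g2\<close> are the first two differences of
    \<open>f\<close> divided by p and p^2. As continuous members of \<open>K2\<close> they are
    constant modulo p, so the conditions of \<open>W2\<close> at 0 carry over to
    \<open>t\<close>.\<close>
  obtain g1 where g1: "g1 \<in> K2" "\<And>s. f (s + of_nat 1) - f s = ?P ^ Suc 0 * g1 s"
    "continuous_on UNIV g1"
    using K2_increment[OF K2, of 0 1] f(2) by auto
  obtain g2 where g2: "g2 \<in> K2" "\<And>s. g1 (s + of_nat 1) - g1 s = ?P ^ Suc 0 * g2 s"
    "continuous_on UNIV g2"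
    using K2_increment[OF g1(1), of 0 1] g1(3) by auto
  have d1: "fdiff 1 1 f s = ?P ^ 1 * g1 s" for s
    using g1(2)[of s] by simp
  have d2: "fdiff 1 2 f s = ?P ^ 2 * g2 s" for s
    unfolding numeral_2_eq_2 fdiff_Suc'[of 1 "Suc 0"] g1(2) fdiff_cmult
    using g2(2)[of s] by simp
  have "Delta_coeff f 1 = g1 0" using d1 by (rule Delta_coeff_eqI)
  then have "\<not> ?P dvd g1 0"
    using f(1) Delta_digit_eq_0[of f] by (auto simp: W2_def)
  moreover have "?P dvd g1 t - g1 0"
    using K2_continuous_lipschitz[OF g1(1,3), of 0 t 0] by simp
  ultimately have g1t: "\<not> ?P dvd g1 t"
    by (metis dvd_diff_right_iff)
  have g2t: "?P dvd g2 t" if "CARD('p) = 2"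
  proof -
    have "Delta_coeff f 2 = g2 0" using d2 by (rule Delta_coeff_eqI)
    then have "?P dvd g2 0" using f(1) that by (simp add: W2_def)
    moreover have "?P dvd g2 t - g2 0"
      using K2_continuous_lipschitz[OF g2(1,3), of 0 t 0] by simp
    ultimately show ?thesis by (metis dvd_diff_left_iff)
  qed
  have "?P ^ (v + 2) dvd (\<Sum>j=2..h. of_nat (h choose j) * fdiff 1 j f t)"
  proof (rule dvd_sum)
    fix j assume "j \<in> {2..h}"
    then have j: "2 \<le> j" by simp
    show "?P ^ (v + 2) dvd of_nat (h choose j) * fdiff 1 j f t"
    \<comment> \<open>The j-th difference carries p^j, and the loss must be at most p^(j-2). For p =
      j = 2 the loss can be p, which the factor p in \<open>g2 t\<close> makes up.\<close>
    proof (cases "CARD('p) = 2 \<and> j = 2")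
      case True
      have "?P ^ (1 + 2) dvd fdiff 1 j f t"
        using True mult_dvd_mono[OF dvd_refl g2t, of "?P ^ 2"] d2[of t]
        by (simp add: power3_eq_cube power2_eq_square)
      moreover have "multiplicity CARD('p) j \<le> 1"
        using multiplicity_lt_self[OF prime_card[where 'a = 'p], of j] True by simp
      ultimately show ?thesis
        using j by (intro uniformizer_power_dvd_choose[OF pv, of j 1]) auto
    next
      case False
      then have "multiplicity CARD('p) j \<le> j - 2"
        using Suc_multiplicity_lt_self[OF prime_card[where 'a = 'p] j] by linarith
      moreover have "?P ^ (j - 2 + 2) dvd fdiff 1 j f t"
        using K2 j unfolding K2_iff by (metis le_add_diff_inverse2)
      ultimately show ?thesis
        using j by (intro uniformizer_power_dvd_choose[OF pv, of j "j - 2"]) auto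
    qed
  qed
  \<comment> \<open>The linear term alone is then divisible by p^(v+2). Since p does not divide
    \<open>g1 t\<close>, this puts p^(v+1) into \<open>h\<close>, against its order
    \<open>v\<close>.\<close>
  then have "?P ^ (v + 2) dvd of_nat h * fdiff 1 1 f t"
    using inc newton_increment_2[of f t h 1] by (simp only: mult_1_right dvd_add_left_iff)
  then have "?P ^ Suc v * ?P dvd (of_nat h * g1 t) * ?P"
    unfolding d1 by (simp add: mult_ac)
  then have *: "?P ^ Suc v dvd of_nat h * g1 t"
    using uniformizer_nonzero[of 1, where 'p = 'p] by (simp only: dvd_mult_cancel_right) simp
  obtain c where c: "of_nat h = ?P ^ v * c"
    using hv[of v] unfolding dvd_def by auto
  have "?P ^ v * ?P dvd ?P ^ v * (c * g1 t)"
    using * unfolding c by (simp add: mult_ac)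
  then have "?P dvd c * g1 t"
    using uniformizer_nonzero[of v, where 'p = 'p] by (simp only: dvd_mult_cancel_left) blast
  then have "?P dvd c"
    using uniformizer_prime g1t by blast
  then have "?P ^ v * ?P dvd of_nat h"
    unfolding c by (rule mult_dvd_mono[OF dvd_refl])
  then show False
    using hv[of "Suc v"] by (simp add: mult.commute)
qed

lemma W2_continuous_subset_W1: "W2 \<inter> {f. continuous_on UNIV f} \<subseteq> W1"
  using K2_continuous_subset_K1 W2_continuous_expansive
  by (fastforce simp: W1_def W2_def pcong_def)

section \<open>A function in \<open>W1\<close> but not in \<open>K2\<close>\<close>

text \<open>The step of size \<open>p^3\<close> is too small to spoil the isometry, but it is not flat enough for
  \<open>K2\<close>: the difference of order 5 sees it only at 0, since \<open>5 < p^3\<close>.\<close>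

definition bump :: "'p::prime_card padic_int \<Rightarrow> 'p padic_int" where
  "bump x = uniformizer * (x + (if uniformizer ^ 3 dvd x then uniformizer ^ 3 else 0))"

text \<open>The two step terms differ by a multiple of p^3. If p^3 divides \<open>s - t\<close> they
  are equal; otherwise their difference is invisible for n <= 3, and for n > 3 both sides
  fail.\<close>

lemma uniformizer_dvd_bump_diff:
  "(uniformizer :: 'p::prime_card padic_int) ^ Suc n dvd bump s - bump t
    \<longleftrightarrow> uniformizer ^ n dvd s - t"
proof -
  let ?P = "uniformizer :: 'p padic_int"
  let ?e = "\<lambda>x::'p padic_int. if ?P ^ 3 dvd x then ?P ^ 3 else 0"
  have "bump s - bump t = ?P * ((s - t) + (?e s - ?e t))"
    unfolding bump_def by (simp only: right_diff_distrib distrib_left) simp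
  moreover have "?P \<noteq> 0" using uniformizer_nonzero[of 1, where 'p = 'p] by simp
  ultimately have 1: "?P ^ Suc n dvd bump s - bump t \<longleftrightarrow> ?P ^ n dvd (s - t) + (?e s - ?e t)"
    by (simp only: power_Suc dvd_mult_cancel_left) blast
  have e3: "?P ^ 3 dvd ?e s - ?e t"
    by (intro dvd_diff) auto
  show ?thesis
  proof (cases "?P ^ 3 dvd s - t")
    case True
    then have "?P ^ 3 dvd s \<longleftrightarrow> ?P ^ 3 dvd t"
      by (metis dvd_diff_left_iff dvd_diff_right_iff)
    then show ?thesis using 1 by simp
  next
    case False
    then have F: "\<not> ?P ^ 3 dvd (s - t) + (?e s - ?e t)"
      using e3 dvd_add_left_iff by blast
    show ?thesis
    proof (cases "n \<le> 3")
      case True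
      have "?P ^ n dvd ?e s - ?e t" using e3 True by (rule power_le_dvd)
      then show ?thesis unfolding 1 by (rule dvd_add_left_iff)
    next
      case n: False
      then have "\<not> ?P ^ n dvd s - t" "\<not> ?P ^ n dvd (s - t) + (?e s - ?e t)"
        using False F power_le_dvd[of ?P n _ 3] by auto
      then show ?thesis using 1 by blast
    qed
  qed
qed

lemma bump_in_W1: "bump \<in> W1"
  by (simp add: W1_def K1_def pcong_def uniformizer_dvd_bump_diff del: power_Suc)

text \<open>The fifth difference annihilates the linear part p * x and leaves only the step at 0,
  namely -p^4, which p^5 does not divide.\<close>

lemma bump_notin_K2: "(bump :: 'p::prime_card padic_int \<Rightarrow> _) \<notin> K2"
proof
  let ?P = "uniformizer :: 'p padic_int"
  assume "(bump :: 'p padic_int \<Rightarrow> _) \<in> K2"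
  then have dvd: "?P ^ 5 dvd fdiff 1 5 bump 0" by (simp only: K2_iff)
  \<comment> \<open>As p^3 >= 8, none of the arguments 1 to 5 is a multiple of p^3.\<close>
  have "2 ^ 3 \<le> CARD('p) ^ 3"
    using prime_ge_2_nat[OF prime_card[where 'a = 'p]] by (rule power_mono) simp
  then have "\<not> CARD('p) ^ 3 dvd k" if "0 < k" "k < 8" for k
    using that by (auto dest!: dvd_imp_le)
  then have b: "bump (of_nat k) = ?P * of_nat k" if "0 < k" "k < 8" for k
    using that uniformizer_power_dvd_of_nat[of 3 k, where 'p = 'p] by (simp add: bump_def)
  have "fdiff 1 5 bump 0 = - bump 0 + 5 * bump (of_nat 1) - 10 * bump (of_nat 2)
      + 10 * bump (of_nat 3) - 5 * bump (of_nat 4) + bump (of_nat 5)"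
    unfolding fdiff_def by (simp add: numeral_eq_Suc)
  also have "\<dots> = - (?P ^ 4)"
    by (simp only: b) (simp add: bump_def algebra_simps numeral_eq_Suc)
  finally have "?P ^ 5 dvd ?P ^ 4" using dvd by simp
  then have "?P ^ 5 dvd of_nat (CARD('p) ^ 4)" by simp
  then have "CARD('p) ^ 5 dvd CARD('p) ^ 4" unfolding uniformizer_power_dvd_of_nat .
  then show False
    using prime_gt_1_nat[OF prime_card[where 'a = 'p]] by (auto dest!: power_dvd_imp_le)
qed

section \<open>Strict differentiability\<close>

text \<open>The term j >= 2 carries p^(j(M+1)) and loses at most p^(j-1); the exponent jM + 1 left
  over is at least 2M + 1.\<close>

lemma K2_increment_linear:
  fixes f :: "'p::prime_card padic_int \<Rightarrow> 'p padic_int"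
  assumes f: "f \<in> K2" and k: "CARD('p) ^ v dvd k"
  shows "uniformizer ^ (v + (2 * M + 1)) dvd
    f (s + of_nat (k * CARD('p) ^ M)) - f s - of_nat k * fdiff (CARD('p) ^ M) 1 f s"
proof -
  have "f (s + of_nat (k * CARD('p) ^ M)) - f s - of_nat k * fdiff (CARD('p) ^ M) 1 f s
      = (\<Sum>j=2..k. of_nat (k choose j) * fdiff (CARD('p) ^ M) j f s)"
    unfolding newton_increment_2 by simp
  also have "uniformizer ^ (v + (2 * M + 1)) dvd \<dots>"
  proof (rule dvd_sum)
    fix j assume "j \<in> {2..k}"
    then have j: "2 \<le> j" by simp
    then obtain i where i: "j = i + 2" by (metis add.commute le_Suc_ex)
    have "uniformizer ^ (j * Suc M) dvd fdiff (CARD('p) ^ M) j f s"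
      using K2_fdiff_dvd[OF f, of M] by simp
    then have "uniformizer ^ ((j - 1) + (2 * M + 1)) dvd fdiff (CARD('p) ^ M) j f s"
      by (rule power_le_dvd) (simp add: i)
    moreover have "multiplicity CARD('p) j \<le> j - 1"
      using multiplicity_lt_self[OF prime_card[where 'a = 'p], of j] j by linarith
    ultimately show "uniformizer ^ (v + (2 * M + 1))
        dvd of_nat (k choose j) * fdiff (CARD('p) ^ M) j f s"
      using j by (intro uniformizer_power_dvd_choose[OF k, of j "j - 1"]) simp_all
  qed
  finally show ?thesis .
qed

text \<open>The derivative modulo \<open>p^(M+1)\<close> is the difference quotient with step \<open>p^M\<close>.\<close>

lemma K2_continuous_slope:
  fixes f :: "'p::prime_card padic_int \<Rightarrow> 'p padic_int"
  assumes f: "f \<in> K2" "continuous_on UNIV f"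
  obtains l where "uniformizer ^ M * l = f (a + uniformizer ^ M) - f a"
    and "\<And>x y w. uniformizer ^ M dvd x - a \<Longrightarrow> uniformizer ^ M dvd y - a \<Longrightarrow>
      uniformizer ^ w dvd x - y \<Longrightarrow> M \<le> w \<Longrightarrow>
      uniformizer ^ (w + Suc M) dvd f x - f y - (x - y) * l"
proof -
  let ?P = "uniformizer :: 'p padic_int"
  obtain g where g: "g \<in> K2"
    "\<And>s. f (s + of_nat (CARD('p) ^ M)) - f s = ?P ^ Suc M * g s" "continuous_on UNIV g"
    using K2_increment[OF f(1), of M "CARD('p) ^ M"] f(2) by auto
  define l where "l = ?P * g a"
  have "?P ^ M * l = f (a + ?P ^ M) - f a"
    using g(2)[of a] by (simp add: l_def mult_ac)
  moreover have "?P ^ (w + Suc M) dvd f x - f y - (x - y) * l"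
    if x: "?P ^ M dvd x - a" and y: "?P ^ M dvd y - a"
      and w: "?P ^ w dvd x - y" and Mw: "M \<le> w" for x y w
  proof -
    obtain h where h: "?P ^ (w + Suc M) dvd y + of_nat h - x"
      and fh: "?P ^ (w + Suc M) dvd f (y + of_nat h) - f x"
      using continuous_padic_approx[OF f(2)] by blast
    have "?P ^ w dvd y + of_nat h - x" using h by (rule power_le_dvd) simp
    from dvd_add[OF this w] have "CARD('p) ^ w dvd h"
      by (simp add: uniformizer_power_dvd_of_nat)
    then obtain c where c: "h = CARD('p) ^ w * c" by (rule dvdE)
    \<comment> \<open>Counted in steps of p^M, the number of steps is divisible by p^(w-M), so the
      error exponent is (w - M) + (2M + 1) = w + M + 1.\<close>
    define k where "k = CARD('p) ^ (w - M) * c"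
    have hk: "h = k * CARD('p) ^ M"
      using Mw by (simp add: c k_def flip: power_add)
    have "?P ^ (w - M + (2 * M + 1)) dvd
        f (y + of_nat h) - f y - of_nat k * fdiff (CARD('p) ^ M) 1 f y"
      unfolding hk by (rule K2_increment_linear[OF f(1)]) (simp add: k_def)
    also have "w - M + (2 * M + 1) = w + Suc M" using Mw by simp
    also have "of_nat k * fdiff (CARD('p) ^ M) 1 f y = of_nat h * (?P * g y)"
      using g(2)[of y] by (simp add: hk mult_ac)
    finally have 1: "?P ^ (w + Suc M) dvd f (y + of_nat h) - f y - of_nat h * (?P * g y)" .
    \<comment> \<open>This moves the slope from base point \<open>y\<close> to \<open>a\<close>:
      \<open>g\<close> gains p^(M+1), and \<open>x - y\<close> supplies p^w.\<close>
    have "?P ^ Suc M dvd g y - g a"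
      using K2_continuous_lipschitz[OF g(1,3) y] .
    then have "?P ^ Suc M dvd ?P * (g y - g a)" by (rule dvd_mult)
    then have "?P ^ w * ?P ^ Suc M dvd (x - y) * (?P * (g y - g a))"
      using w by (intro mult_dvd_mono)
    then have 2: "?P ^ (w + Suc M) dvd (x - y) * (?P * (g y - g a))"
      by (simp only: power_add)
    have 3: "?P ^ (w + Suc M) dvd (y + of_nat h - x) * (?P * g y)"
      using h by (rule dvd_mult2)
    have "f x - f y - (x - y) * l = (f (y + of_nat h) - f y - of_nat h * (?P * g y))
        - (f (y + of_nat h) - f x) + (x - y) * (?P * (g y - g a)) + (y + of_nat h - x) * (?P * g y)"
      by (simp add: l_def algebra_simps)
    also have "?P ^ (w + Suc M) dvd \<dots>"
      by (intro dvd_add dvd_diff 1 2 3 fh)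
    finally show ?thesis .
  qed
  ultimately show ?thesis using that by blast
qed

text \<open>The slopes for the steps p^M form a Cauchy sequence: the estimate at scale M, applied to
  a + p^(M+1) and a, compares consecutive ones. Their limit agrees with slope M modulo p^M, so the
  estimate survives with exponent \<open>w + M\<close>.\<close>

lemma K2_continuous_derivative:
  fixes f :: "'p::prime_card padic_int \<Rightarrow> 'p padic_int"
  assumes f: "f \<in> K2" "continuous_on UNIV f"
  obtains L where "\<And>x y w M. uniformizer ^ M dvd x - a \<Longrightarrow> uniformizer ^ M dvd y - a \<Longrightarrow>
      uniformizer ^ w dvd x - y \<Longrightarrow> M \<le> w \<Longrightarrow> uniformizer ^ (w + M) dvd f x - f y - (x - y) * L"
proof -
  let ?P = "uniformizer :: 'p padic_int"
  have "\<forall>M. \<exists>l. ?P ^ M * l = f (a + ?P ^ M) - f a \<and>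
    (\<forall>x y w. ?P ^ M dvd x - a \<longrightarrow> ?P ^ M dvd y - a \<longrightarrow> ?P ^ w dvd x - y \<longrightarrow> M \<le> w \<longrightarrow>
      ?P ^ (w + Suc M) dvd f x - f y - (x - y) * l)"
    by (rule allI, rule K2_continuous_slope[OF f]) blast
  then obtain l where l: "\<And>M. ?P ^ M * l M = f (a + ?P ^ M) - f a"
    and approx: "\<And>M x y w. ?P ^ M dvd x - a \<Longrightarrow> ?P ^ M dvd y - a \<Longrightarrow> ?P ^ w dvd x - y \<Longrightarrow> M \<le> w \<Longrightarrow>
      ?P ^ (w + Suc M) dvd f x - f y - (x - y) * l M"
    by metis
  have "?P ^ M dvd l (Suc M) - l M" for M
  proof -
    have "?P ^ (Suc M + Suc M) dvd f (a + ?P ^ Suc M) - f a - ((a + ?P ^ Suc M) - a) * l M"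
      by (rule approx) simp_all
    also have "\<dots> = ?P ^ Suc M * (l (Suc M) - l M)"
      unfolding l[symmetric] by (simp add: algebra_simps)
    finally have "?P ^ Suc M dvd l (Suc M) - l M"
      unfolding power_add using uniformizer_nonzero[of "Suc M", where 'p = 'p]
      by (simp only: dvd_mult_cancel_left) blast
    then show ?thesis by (rule power_le_dvd) simp
  qed
  from padic_complete[of l, OF this] obtain L where L: "\<And>M. ?P ^ M dvd L - l M" by blast
  show ?thesis
  proof
    fix x y w M
    assume *: "?P ^ M dvd x - a" "?P ^ M dvd y - a" "?P ^ w dvd x - y" "M \<le> w"
    have "?P ^ (w + M) dvd f x - f y - (x - y) * l M"
      using approx[OF *] by (rule power_le_dvd) simp
    moreover have "?P ^ (w + M) dvd (x - y) * (L - l M)"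
      unfolding power_add using *(3) L by (rule mult_dvd_mono)
    ultimately have "?P ^ (w + M) dvd (f x - f y - (x - y) * l M) - (x - y) * (L - l M)"
      by (rule dvd_diff)
    then show "?P ^ (w + M) dvd f x - f y - (x - y) * L"
      by (simp add: algebra_simps)
  qed
qed

text \<open>Dividing the uniform estimate by \<open>x - y\<close>, with \<open>w\<close> its exact
  order, bounds the error of the difference quotient by p^(-M) once \<open>x\<close> and
  \<open>y\<close> lie within p^(-M) of \<open>a\<close>.\<close>

lemma K2_continuous_strictly_differentiable:
  fixes f :: "'p::prime_card padic_int \<Rightarrow> 'p padic_int"
  assumes f: "f \<in> K2" "continuous_on UNIV f"
  shows "strictly_differentiable_at f a"
proof -
  let ?P = "uniformizer :: 'p padic_int"
  let ?q = "inverse (real CARD('p))"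
  obtain L where L: "\<And>x y w M. ?P ^ M dvd x - a \<Longrightarrow> ?P ^ M dvd y - a \<Longrightarrow>
      ?P ^ w dvd x - y \<Longrightarrow> M \<le> w \<Longrightarrow> ?P ^ (w + M) dvd f x - f y - (x - y) * L"
    using K2_continuous_derivative[OF f] by blast
  have p1: "real CARD('p) > 1" using CARD_gt_1[where 'p = 'p] by linarith
  then have q: "0 < ?q" "?q < 1" by (auto simp: field_simps)
  have bound: "Qp_abs (Fract (f x - f y) (x - y) - Fract L 1) \<le> ?q ^ M"
    if xy: "x \<noteq> y" and x: "?P ^ M dvd x - a" and y: "?P ^ M dvd y - a" for x y M
  proof -
    define w where "w = padic_ord (x - y)"
    have "?P ^ M dvd x - y" using dvd_diff[OF x y] by simp
    then have Mw: "M \<le> w"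
      using p_power_dvd_iff_le_ord[of "x - y" M] xy by (simp add: w_def)
    have w: "?P ^ w dvd x - y"
      using p_power_dvd_iff_le_ord[of "x - y" w] xy by (simp add: w_def)
    have "padic_abs (f x - f y - (x - y) * L) \<le> ?q ^ (w + M)"
      unfolding padic_abs_le_iff by (rule L[OF x y w Mw])
    moreover have "padic_abs (x - y) = ?q ^ w"
      using xy by (simp add: padic_abs_def w_def)
    moreover have "Fract (f x - f y) (x - y) - Fract L 1 = Fract (f x - f y - (x - y) * L) (x - y)"
      using xy by (simp add: mult.commute)
    ultimately show ?thesis
      using xy p1 q by (simp add: Qp_abs_Fract power_add divide_le_eq mult.commute)
  qed
  have nonneg: "0 \<le> Qp_abs (Fract (f x - f y) (x - y) - Fract L 1)" if "x \<noteq> y" for x y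
    using that by (simp add: Qp_abs_Fract padic_abs_nonneg)
  have "((\<lambda>(x, y). Qp_abs (Fract (f x - f y) (x - y) - Fract L 1)) \<longlongrightarrow> 0)
      (at (a, a) within {(x, y). x \<noteq> y})"
  proof (rule tendstoI)
    fix e :: real assume "0 < e"
    then obtain M where M: "?q ^ M < e" using real_arch_pow_inv[OF _ q(2)] by blast
    have "dist (case z of (x, y) \<Rightarrow> Qp_abs (Fract (f x - f y) (x - y) - Fract L 1)) 0 < e"
      if z: "z \<in> {(x, y). x \<noteq> y}" "dist z (a, a) < ?q ^ M" for z
    proof -
      obtain x y where xy: "z = (x, y)" "x \<noteq> y" using z(1) by auto
      have "dist x a < ?q ^ M" "dist y a < ?q ^ M"
        using z(2) dist_fst_le[of z "(a, a)"] dist_snd_le[of z "(a, a)"] by (auto simp: xy(1))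
      then have "?P ^ M dvd x - a" "?P ^ M dvd y - a"
        by (simp_all only: dist_padic_int_def flip: padic_abs_le_iff)
      from bound[OF xy(2) this] nonneg[OF xy(2)] M show ?thesis
        by (simp add: xy(1))
    qed
    then show "\<forall>\<^sub>F z in at (a, a) within {(x, y). x \<noteq> y}.
        dist (case z of (x, y) \<Rightarrow> Qp_abs (Fract (f x - f y) (x - y) - Fract L 1)) 0 < e"
      unfolding eventually_at using q(1) by (intro exI[of _ "?q ^ M"]) auto
  qed
  then show ?thesis unfolding strictly_differentiable_at_def by blast
qed

theorem theorem3p5:
  fixes C :: "('p::prime_card padic_int \<Rightarrow> 'p padic_int) set"
  defines "C \<equiv> {f. continuous_on UNIV f}"
  shows "(K2 \<inter> C \<subset> K1) \<and>
    (W2 \<inter> C \<subset> W1) \<and>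
    ((K2 :: ('p padic_int \<Rightarrow> 'p padic_int) set) = K2_hat) \<and>
    (\<forall>f \<in> K2 \<inter> C. \<forall>a. strictly_differentiable_at f a)"
proof (intro conjI)
  \<comment> \<open>One witness for both strict inclusions: \<open>bump\<close> lies in
    \<open>W1\<close>, hence in \<open>K1\<close>, but outside \<open>K2\<close>, hence outside
    \<open>W2\<close>.\<close>
  have "(bump :: 'p padic_int \<Rightarrow> _) \<in> K1" "(bump :: 'p padic_int \<Rightarrow> _) \<notin> W2"
    using bump_in_W1 bump_notin_K2 by (auto simp: W1_def W2_def)
  then show "K2 \<inter> C \<subset> K1" "W2 \<inter> C \<subset> W1"
    using K2_continuous_subset_K1 W2_continuous_subset_W1 bump_in_W1 bump_notin_K2
    unfolding C_def by blast+
  show "(K2 :: ('p padic_int \<Rightarrow> 'p padic_int) set) = K2_hat"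
    by (rule K2_eq_K2_hat)
  show "\<forall>f \<in> K2 \<inter> C. \<forall>a. strictly_differentiable_at f a"
    using K2_continuous_strictly_differentiable by (auto simp: C_def)
qed

end
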